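(* For $\gamma\ge 1$, the function $f_\gamma:[0,1)\to\mathbb{R}_+$, defined as $f_\gamma(\alpha)=\sum_{k=0}^{\gamma}\alpha^k$, is increasing on $[0,1)$ and convex for $\gamma\ge 2$ (linear when $\gamma=1$). Consequently, for fixed $(\gamma,c)$, the task-level speed-up $S_T$ on a task $T$ is lower-bounded through the following chain: $$S_T\;\ge\;\frac{f_\gamma(\alpha_T)}{1+\gamma c}\;\ge\;\frac{f_\gamma\Big(1-\sqrt{\tfrac12\,\mathrm{KL}_T}\Big)}{1+\gamma c}\;\ge\;\frac{f_\gamma\Big(1-\sqrt{\tfrac12\,\mathbf{D}_T}\Big)}{1+\gamma c}.$$
   Context: Let $\mathcal V$ be a token vocabulary and $\mathcal V^*$ the set of finite sequences (prefixes) over $\mathcal V$. For each prefix $s\in\mathcal V^*$, $p(\cdot\mid s)$ (verifier) and $q(\cdot\mid s)$ (drafter) are probability distributions on $\mathcal V$. A task $T$ is a probability distribution over prefixes $s\in\mathcal V^*$. The integer $\gamma\in\mathbb N$ is the number of speculative guesses (drafted tokens) per iteration, and $c\in[0,1)$ is the drafter cost ratio (time of a drafter pass divided by time of a verifier pass). Define: - Acceptance rate at $s$: $\alpha(s)=\sum_{x\in\mathcal V}\min\big(q(x\mid s),p(x\mid s)\big)$; task-wise acceptance: $\alpha_T=\mathbb E_{s\sim T}[\alpha(s)]$. - Task-level speed-up: $S_T=\mathbb E_{s\sim T}\Big[\frac{f_\gamma(\alpha(s))}{1+\gamma c}\Big]$. - Task-wise Kullback–Leibler divergence: $\mathrm{KL}_T=\mathbb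 E_{s\sim T}\big[D_{\mathrm{KL}}(p(\cdot\mid s)\,\Vert\,q(\cdot\mid s))\big]$, where $D_{\mathrm{KL}}(p\,\Vert\,q)=\sum_{x\in\mathcal V}p(x)\log\frac{p(x)}{q(x)}$. - Task-wise cross-entropy: $\mathbf D_T=\mathbb E_{s\sim T}\big[-\sum_{x\in\mathcal V}p(x\mid s)\log q(x\mid s)\big]$. Here $\log$ is the natural logarithm.
   Formalization: Since f_γ is only defined on [0,1), the second inequality is proved under KL_T ≤ 2 and the third under D_T ≤ 2 (nonnegative arguments; 1 allowed). Extended as a polynomial, the chain fails: γ=2, point task, p(a)=1, q(a)=e^{-18} gives f_2(-2)=3 > f_2(α_T). *)

theory Defs
  imports "HOL-Probability.Probability"
begin

text \<open>
  Prefixes over the vocabulary \<^typ>\<open>'v\<close> are lists.  The verifier \<open>p\<close> and the drafter \<open>q\<close>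
  have type \<^typ>\<open>'v list \<Rightarrow> 'v pmf\<close>, and a task \<open>T\<close> has type \<^typ>\<open>'v list pmf\<close>.  The vocabulary
  is not required to be finite; for a finite one, all sums \<open>\<Sum>\<^sub>\<infinity>x\<close> below are finite sums.
\<close>

text \<open>
  The intended domain is \<open>[0,1)\<close>.  The polynomial is also used at \<open>\<alpha> = 1\<close>, since an acceptance
  rate equals 1 wherever drafter and verifier agree.  Negative arguments are outside the domain:
  for even \<open>\<gamma>\<close> the polynomial is unbounded there.  An argument \<open>1 - sqrt (1/2 * D)\<close> with
  \<open>D \<in> [0,\<infinity>]\<close> is thus admissible exactly if \<open>D \<le> 2\<close>.
\<close>

definition f_spec :: "nat \<Rightarrow> real \<Rightarrow> real" where
  "f_spec \<gamma> \<alpha> = (\<Sum>k=0..\<gamma>. \<alpha> ^ k)"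

definition acceptance :: "('v list \<Rightarrow> 'v pmf) \<Rightarrow> ('v list \<Rightarrow> 'v pmf) \<Rightarrow> 'v list \<Rightarrow> real" where
  "acceptance p q s = (\<Sum>\<^sub>\<infinity>x. min (pmf (q s) x) (pmf (p s) x))"

definition task_acceptance ::
  "('v list \<Rightarrow> 'v pmf) \<Rightarrow> ('v list \<Rightarrow> 'v pmf) \<Rightarrow> 'v list pmf \<Rightarrow> real" where
  "task_acceptance p q T = measure_pmf.expectation T (\<lambda>s. acceptance p q s)"

definition task_speedup ::
  "nat \<Rightarrow> real \<Rightarrow> ('v list \<Rightarrow> 'v pmf) \<Rightarrow> ('v list \<Rightarrow> 'v pmf) \<Rightarrow> 'v list pmf \<Rightarrow> real" where
  "task_speedup \<gamma> c p q T =
     measure_pmf.expectation T (\<lambda>s. f_spec \<gamma> (acceptance p q s) / (1 + real \<gamma> * c))"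

text \<open>
  Extended natural logarithm.  Together with the arithmetic of \<^typ>\<open>ereal\<close>, where \<open>0 * \<plusminus>\<infinity> = 0\<close>
  and \<open>a / 0 = \<infinity>\<close> for \<open>a > 0\<close>, it yields the usual conventions in the two sums below:
  terms with \<open>p x = 0\<close> vanish, and those with \<open>p x > 0 = q x\<close> contribute \<open>\<infinity>\<close> to the divergence
  and to the cross-entropy.
\<close>

definition eln :: "ereal \<Rightarrow> ereal" where
  "eln x = (if x \<le> 0 then -\<infinity> else if x = \<infinity> then \<infinity> else ereal (ln (real_of_ereal x)))"

definition kl_div :: "'v pmf \<Rightarrow> 'v pmf \<Rightarrow> ereal" where
  "kl_div P Q = (\<Sum>\<^sub>\<infinity>x. ereal (pmf P x) * eln (ereal (pmf P x) / ereal (pmf Q x)))"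

definition cross_ent :: "'v pmf \<Rightarrow> 'v pmf \<Rightarrow> ereal" where
  "cross_ent P Q = - (\<Sum>\<^sub>\<infinity>x. ereal (pmf P x) * eln (ereal (pmf Q x)))"

text \<open>
  Both quantities are nonnegative and both sums converge in \<^typ>\<open>ereal\<close> (shown below), so the
  conversion to \<^typ>\<open>ennreal\<close> loses nothing, and the expectations exist in \<open>[0,\<infinity>]\<close>.
\<close>

definition task_kl :: "('v list \<Rightarrow> 'v pmf) \<Rightarrow> ('v list \<Rightarrow> 'v pmf) \<Rightarrow> 'v list pmf \<Rightarrow> ennreal" where
  "task_kl p q T = (\<integral>\<^sup>+s. e2ennreal (kl_div (p s) (q s)) \<partial>measure_pmf T)"

definition task_cross_ent ::
  "('v list \<Rightarrow> 'v pmf) \<Rightarrow> ('v list \<Rightarrow> 'v pmf) \<Rightarrow> 'v list pmf \<Rightarrow> ennreal" where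
  "task_cross_ent p q T = (\<integral>\<^sup>+s. e2ennreal (cross_ent (p s) (q s)) \<partial>measure_pmf T)"

lemma ereal_nonneg_has_sum_ex:
  fixes f :: "'a \<Rightarrow> ereal"
  assumes "\<And>x. f x \<ge> 0"
  shows "\<exists>S\<ge>0. (f has_sum S) UNIV"
proof -
  have *: "(f has_sum (SUP F\<in>{F. finite F \<and> F\<subseteq>UNIV}. sum f F)) UNIV"
    by (rule nonneg_bdd_above_has_sum) (use assms in auto)
  moreover have "(SUP F\<in>{F. finite F \<and> F\<subseteq>UNIV}. sum f F) \<ge> 0"
    by (rule SUP_upper2[of "{}"]) auto
  ultimately show ?thesis by blast
qed

lemma pmf_has_sum_1: "((\<lambda>x. pmf P x) has_sum 1) UNIV"
proof -
  have "Infinite_Set_Sum.abs_summable_on (pmf P) UNIV"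
    by (rule pmf_abs_summable)
  then have "(pmf P has_sum infsetsum (pmf P) UNIV) UNIV"
    by (metis abs_summable_equivalent abs_summable_summable has_sum_infsum infsetsum_infsum)
  then show ?thesis
    by (simp add: infsetsum_pmf_eq_1)
qed

lemma kl_div_has_sum:
  "((\<lambda>x. ereal (pmf P x) * eln (ereal (pmf P x) / ereal (pmf Q x))) has_sum kl_div P Q) UNIV"
  and kl_div_nonneg: "kl_div P Q \<ge> 0"
proof -
  define t where "t = (\<lambda>x. ereal (pmf P x) * eln (ereal (pmf P x) / ereal (pmf Q x)))"
  define d where "d = (\<lambda>x. ereal (pmf P x - pmf Q x))"
  have nn: "t x - d x \<ge> 0" for x
  proof (cases "pmf P x = 0 \<or> pmf Q x = 0")
    case True
    then show ?thesis
      by (auto simp: t_def d_def eln_def zero_ereal_def[symmetric] ereal_divide_eq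
          pmf_nonneg less_le)
  next
    case False
    then have pos: "pmf P x > 0" "pmf Q x > 0"
      by (simp_all add: pmf_pos)
    have "ln (pmf Q x / pmf P x) \<le> pmf Q x / pmf P x - 1"
      using pos by (intro ln_le_minus_one) auto
    then have "pmf P x * ln (pmf Q x / pmf P x) \<le> pmf P x * (pmf Q x / pmf P x - 1)"
      using pos by (intro mult_left_mono) auto
    also have "\<dots> = pmf Q x - pmf P x"
      using pos by (simp add: right_diff_distrib)
    finally have "pmf P x * ln (pmf P x / pmf Q x) \<ge> pmf P x - pmf Q x"
      using pos by (simp add: ln_div right_diff_distrib)
    moreover have "\<not> pmf P x / pmf Q x \<le> 0"
      using pos by (simp add: not_le)
    ultimately show ?thesis
      using pos by (simp add: t_def d_def eln_def)
  qed
  then obtain S where S: "S \<ge> 0" "((\<lambda>x. t x - d x) has_sum S) UNIV"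
    using ereal_nonneg_has_sum_ex[of "\<lambda>x. t x - d x"] by auto
  have "((\<lambda>x. pmf P x - pmf Q x) has_sum 0) UNIV"
    using has_sum_add[OF pmf_has_sum_1[of P] has_sum_uminusI[OF pmf_has_sum_1[of Q]]]
    by simp
  then have "((\<lambda>F. \<Sum>x\<in>F. pmf P x - pmf Q x) \<longlongrightarrow> 0) (finite_subsets_at_top UNIV)"
    by (simp add: has_sum_def)
  then have "((\<lambda>F. ereal (\<Sum>x\<in>F. pmf P x - pmf Q x)) \<longlongrightarrow> ereal 0) (finite_subsets_at_top UNIV)"
    by (rule tendsto_ereal)
  moreover have "sum d = (\<lambda>F. ereal (\<Sum>x\<in>F. pmf P x - pmf Q x))"
    by (simp add: d_def fun_eq_iff)
  ultimately have d: "(sum d \<longlongrightarrow> 0) (finite_subsets_at_top UNIV)"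
    by (simp only: zero_ereal_def)
  have "((\<lambda>F. sum (\<lambda>x. t x - d x) F + sum d F) \<longlongrightarrow> S + 0) (finite_subsets_at_top UNIV)"
    using S d by (intro tendsto_add_ereal_nonneg) (auto simp: has_sum_def)
  moreover have "sum (\<lambda>x. t x - d x) F + sum d F = sum t F" for F
  proof -
    have "t x - d x + d x = t x" for x
      by (cases "t x") (auto simp: d_def)
    then show ?thesis by (simp flip: sum.distrib)
  qed
  ultimately have ts: "(t has_sum S) UNIV"
    by (simp add: has_sum_def)
  then have "kl_div P Q = S"
    by (simp add: kl_div_def t_def infsumI)
  with ts S show "((\<lambda>x. ereal (pmf P x) * eln (ereal (pmf P x) / ereal (pmf Q x)))
      has_sum kl_div P Q) UNIV" "kl_div P Q \<ge> 0"
    by (simp_all add: t_def)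
qed

lemma cross_ent_has_sum:
  "((\<lambda>x. ereal (pmf P x) * eln (ereal (pmf Q x))) has_sum - cross_ent P Q) UNIV"
  and cross_ent_nonneg: "cross_ent P Q \<ge> 0"
proof -
  define t where "t = (\<lambda>x. ereal (pmf P x) * eln (ereal (pmf Q x)))"
  have np: "t x \<le> 0" for x
    by (auto simp: t_def eln_def ereal_mult_le_0_iff pmf_le_1 mult_nonneg_nonpos)
  then obtain S where S: "S \<ge> 0" "((\<lambda>x. - t x) has_sum S) UNIV"
    using ereal_nonneg_has_sum_ex[of "\<lambda>x. - t x"] by auto
  have "((\<lambda>F. - sum (\<lambda>x. - t x) F) \<longlongrightarrow> - S) (finite_subsets_at_top UNIV)"
    using S by (simp add: has_sum_def)
  moreover have "- sum (\<lambda>x. - t x) F = sum t F" for F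
  proof (induction F rule: infinite_finite_induct)
    case (insert x F)
    have "sum t F \<le> 0" using np by (simp add: sum_nonpos)
    with insert np[of x] show ?case
      by (cases "t x"; cases "sum t F"; cases "\<Sum>x\<in>F. - t x") auto
  qed auto
  ultimately have ts: "(t has_sum - S) UNIV"
    by (simp add: has_sum_def)
  then have "cross_ent P Q = S"
    by (simp add: cross_ent_def t_def infsumI)
  with ts S show "((\<lambda>x. ereal (pmf P x) * eln (ereal (pmf Q x))) has_sum - cross_ent P Q) UNIV"
    "cross_ent P Q \<ge> 0"
    by (simp_all add: t_def)
qed

end

theory Submission
  imports Defs
begin

text \<open>
  The speed-up bound is Jensen's inequality, obtained by averaging the tangent line of \<open>f\<^sub>\<gamma>\<close>
  at \<open>\<alpha>\<^sub>T\<close>.  For the second inequality, Pinsker's inequality is proved in the linearised form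
  \<open>4 l (1 - \<alpha>) - 2 l\<^sup>2 \<le> KL\<close> for all \<open>l \<ge> 0\<close>.  Being linear in \<open>\<alpha>\<close> and \<open>KL\<close>, it survives averaging
  over the task, and \<open>l = 1 - \<alpha>\<^sub>T\<close> then gives \<open>2 (1 - \<alpha>\<^sub>T)\<^sup>2 \<le> KL\<^sub>T\<close> without a separate
  concavity argument for the square root.  The last inequality holds since the cross-entropy
  exceeds the divergence by the entropy of the verifier.
\<close>

section \<open>The polynomial\<close>

lemma power_above_tangent:
  fixes a m :: real
  assumes "a \<ge> 0" "m \<ge> 0"
  shows "a ^ k \<ge> m ^ k + real k * m ^ (k - 1) * (a - m)"
proof (induction k)
  case (Suc k)
  show ?case
  proof (cases k)
    case 0
    then show ?thesis by simp
  next
    case (Suc j)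
    have "0 \<le> real k * m ^ j * (a - m)\<^sup>2"
      using assms by simp
    then have "m ^ Suc k + real (Suc k) * m ^ k * (a - m)
        \<le> a * (m ^ k + real k * m ^ (k - 1) * (a - m))"
      by (simp add: Suc algebra_simps power2_eq_square)
    also have "\<dots> \<le> a * a ^ k"
      using Suc.IH assms by (intro mult_left_mono)
    finally show ?thesis by simp
  qed
qed simp

lemma f_spec_above_tangent:
  assumes "m \<ge> 0"
  obtains d where "\<And>a. a \<ge> 0 \<Longrightarrow> f_spec \<gamma> a \<ge> f_spec \<gamma> m + d * (a - m)"
proof
  fix a :: real
  assume "a \<ge> 0"
  have "(\<Sum>k=0..\<gamma>. m ^ k + real k * m ^ (k - 1) * (a - m)) \<le> f_spec \<gamma> a"
    unfolding f_spec_def using \<open>a \<ge> 0\<close> assms by (intro sum_mono power_above_tangent)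
  then show "f_spec \<gamma> a \<ge> f_spec \<gamma> m + (\<Sum>k=0..\<gamma>. real k * m ^ (k - 1)) * (a - m)"
    by (simp add: f_spec_def sum.distrib sum_distrib_right)
qed

lemma convex_on_f_spec: "convex_on {0..} (f_spec \<gamma>)"
proof (rule convex_onI)
  fix t x y :: real
  assume t: "0 < t" "t < 1" and xy: "x \<in> {0..}" "y \<in> {0..}"
  define m where "m = (1 - t) * x + t * y"
  have "m \<ge> 0" using t xy by (simp add: m_def)
  then obtain d where d: "\<And>a. a \<ge> 0 \<Longrightarrow> f_spec \<gamma> a \<ge> f_spec \<gamma> m + d * (a - m)"
    using f_spec_above_tangent by blast
  have "(1 - t) * (f_spec \<gamma> m + d * (x - m)) + t * (f_spec \<gamma> m + d * (y - m))
      \<le> (1 - t) * f_spec \<gamma> x + t * f_spec \<gamma> y"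
    using t xy by (intro add_mono mult_left_mono d) auto
  moreover have "(1 - t) * (f_spec \<gamma> m + d * (x - m)) + t * (f_spec \<gamma> m + d * (y - m))
      = f_spec \<gamma> m"
    by (simp add: m_def algebra_simps)
  ultimately show "f_spec \<gamma> ((1 - t) *\<^sub>R x + t *\<^sub>R y) \<le> (1 - t) * f_spec \<gamma> x + t * f_spec \<gamma> y"
    by (simp add: m_def)
qed simp

lemma f_spec_mono: "0 \<le> x \<Longrightarrow> x \<le> y \<Longrightarrow> f_spec \<gamma> x \<le> f_spec \<gamma> y"
  unfolding f_spec_def by (intro sum_mono power_mono)

lemma f_spec_strict_mono:
  assumes "\<gamma> \<ge> 1" "0 \<le> x" "x < y"
  shows "f_spec \<gamma> x < f_spec \<gamma> y"
  unfolding f_spec_def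
proof (rule sum_strict_mono_ex1)
  show "\<forall>k\<in>{0..\<gamma>}. x ^ k \<le> y ^ k"
    using assms by (auto intro: power_mono)
  show "\<exists>k\<in>{0..\<gamma>}. x ^ k < y ^ k"
    using assms by (intro bexI[of _ 1]) auto
qed simp

lemma f_spec_ge_1: "0 \<le> x \<Longrightarrow> 1 \<le> f_spec \<gamma> x"
  using f_spec_mono[of 0 x \<gamma>] by (simp add: f_spec_def power_0_left sum.delta)

section \<open>Pinsker's inequality\<close>

lemma entropy_quadratic_bound:
  fixes t :: real
  assumes "t > 0"
  shows "3 * (t - 1)\<^sup>2 \<le> (2 * t + 4) * (t * ln t - t + 1)"
proof -
  \<comment> \<open>\<open>(t - 1)\<^sup>2 / (t + 2) = t - 4 + 9 / (t + 2)\<close>, which keeps the derivatives short\<close>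
  define g where "g = (\<lambda>t::real. t * ln t - t + 1 - 3 / 2 * (t - 4 + 9 / (t + 2)))"
  define g' where "g' = (\<lambda>t::real. ln t - 3 / 2 * (1 - 9 / (t + 2)\<^sup>2))"
  define g'' where "g'' = (\<lambda>t::real. 1 / t - 27 / (t + 2) ^ 3)"
  have "g' 1 * (t - 1) \<le> g t - g 1"
  proof (rule f''_imp_f'[of "{0<..}" g g' g''])
    fix x :: real
    assume "x \<in> {0<..}"
    then have x: "x > 0" by simp
    show "DERIV g x :> g' x"
      unfolding g_def g'_def using x
      by (auto intro!: derivative_eq_intros) (simp add: power2_eq_square field_simps)
    show "DERIV g' x :> g'' x"
      unfolding g'_def g''_def using x
      by (auto intro!: derivative_eq_intros) (simp add: divide_simps power3_eq_cube power4_eq_xxxx)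
    have "(x + 2) ^ 3 - 27 * x = (x - 1)\<^sup>2 * (x + 8)"
      by (simp add: power2_eq_square power3_eq_cube algebra_simps)
    moreover have "0 \<le> (x - 1)\<^sup>2 * (x + 8)"
      using x by simp
    ultimately have "27 * x \<le> (x + 2) ^ 3"
      by simp
    then show "g'' x \<ge> 0"
      using x by (simp add: g''_def field_simps)
  qed (use assms in auto)
  then have "0 \<le> g t"
    by (simp add: g_def g'_def)
  then have "0 \<le> (2 * t + 4) * g t"
    using assms by simp
  also have "(2 * t + 4) * g t = (2 * t + 4) * (t * ln t - t + 1) - 3 * (t - 1)\<^sup>2"
    using assms by (simp add: g_def divide_simps) (simp add: power2_eq_square algebra_simps)
  finally show ?thesis by simp
qed

lemma entropy_term_bound:
  fixes a b l :: real
  assumes a: "a > 0" and b: "b > 0"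
  shows "a * ln (a / b) - a + b \<ge> 2 * l * \<bar>a - b\<bar> - l\<^sup>2 * ((2 * a + 4 * b) / 3)"
proof -
  define h where "h = a * ln (a / b) - a + b"
  define w where "w = (2 * a + 4 * b) / 3"
  have w: "w > 0" using a b by (simp add: w_def)
  have "b\<^sup>2 * (3 * (a / b - 1)\<^sup>2) \<le> b\<^sup>2 * ((2 * (a / b) + 4) * (a / b * ln (a / b) - a / b + 1))"
    using entropy_quadratic_bound[of "a / b"] a b by (intro mult_left_mono) auto
  also have "b\<^sup>2 * (3 * (a / b - 1)\<^sup>2) = 3 * (a - b)\<^sup>2"
    using b by (simp add: power2_eq_square field_simps)
  also have "b\<^sup>2 * ((2 * (a / b) + 4) * (a / b * ln (a / b) - a / b + 1))
      = (b * (2 * (a / b) + 4)) * (b * (a / b * ln (a / b) - a / b + 1))"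
    by (simp add: power2_eq_square)
  also have "\<dots> = 3 * w * h"
    using b by (simp add: w_def h_def field_simps)
  finally have "(a - b)\<^sup>2 \<le> w * h" by simp
  moreover have "0 \<le> (\<bar>a - b\<bar> - l * w)\<^sup>2" by simp
  ultimately have "w * (2 * l * \<bar>a - b\<bar> - l\<^sup>2 * w) \<le> w * h"
    by (simp add: power2_diff) (simp add: power2_eq_square algebra_simps)
  then show ?thesis
    using w by (simp add: h_def w_def)
qed

text \<open>The right-hand side uses \<open>\<bar>a - b\<bar> = a + b - 2 min a b\<close>, to match the acceptance rate.\<close>

lemma kl_term_bound:
  assumes l: "l \<ge> 0"
  shows "ereal (pmf P x) * eln (ereal (pmf P x) / ereal (pmf Q x))
    \<ge> ereal ((1 + 2 * l - 2 / 3 * l\<^sup>2) * pmf P x + (2 * l - 1 - 4 / 3 * l\<^sup>2) * pmf Q x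
        - 4 * l * min (pmf Q x) (pmf P x))"
    (is "?t \<ge> ereal ?r")
proof -
  consider "pmf P x = 0" | "pmf P x > 0" "pmf Q x = 0" | "pmf P x > 0" "pmf Q x > 0"
    by (metis pmf_nonneg less_le)
  then show ?thesis
  proof cases
    case 1
    have "0 \<le> (4 * l - 3)\<^sup>2 + 3" by simp
    then have "2 * l - 1 - 4 / 3 * l\<^sup>2 \<le> 0"
      by (simp add: power2_eq_square algebra_simps)
    then have "(2 * l - 1 - 4 / 3 * l\<^sup>2) * pmf Q x \<le> 0"
      by (simp add: mult_nonpos_nonneg)
    then show ?thesis
      using 1 by (simp add: zero_ereal_def[symmetric])
  next
    case 2
    then have "ereal (pmf P x) / ereal (pmf Q x) = \<infinity>"
      by (simp only: ereal_divide) simp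
    with 2 show ?thesis
      by (simp add: eln_def)
  next
    case 3
    have "?r = pmf P x - pmf Q x + 2 * l * \<bar>pmf P x - pmf Q x\<bar>
        - l\<^sup>2 * ((2 * pmf P x + 4 * pmf Q x) / 3)"
      by (simp add: min_def abs_if algebra_simps)
    also have "\<dots> \<le> pmf P x * ln (pmf P x / pmf Q x)"
      using entropy_term_bound[OF 3, of l] by simp
    finally have "?r \<le> pmf P x * ln (pmf P x / pmf Q x)" .
    moreover have "\<not> pmf P x / pmf Q x \<le> 0"
      using 3 by (simp add: not_le)
    ultimately show ?thesis
      using 3 by (simp add: eln_def)
  qed
qed

lemma acceptance_has_sum:
  "((\<lambda>x. min (pmf (q s) x) (pmf (p s) x)) has_sum acceptance p q s) UNIV"
proof -
  have "(\<lambda>x. min (pmf (q s) x) (pmf (p s) x)) summable_on UNIV"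
    by (rule summable_on_comparison_test[OF has_sum_imp_summable[OF pmf_has_sum_1[of "p s"]]]) auto
  then show ?thesis
    by (simp add: acceptance_def)
qed

lemma acceptance_nonneg: "acceptance p q s \<ge> 0"
  by (rule has_sum_nonneg[OF acceptance_has_sum]) auto

lemma acceptance_le_1: "acceptance p q s \<le> 1"
  by (rule has_sum_mono[OF acceptance_has_sum pmf_has_sum_1[of "p s"]]) auto

lemma linearised_pinsker:
  assumes l: "l \<ge> 0"
  shows "kl_div (p s) (q s) \<ge> ereal (4 * l * (1 - acceptance p q s) - 2 * l\<^sup>2)"
proof -
  let ?r = "\<lambda>x. (1 + 2 * l - 2 / 3 * l\<^sup>2) * pmf (p s) x + (2 * l - 1 - 4 / 3 * l\<^sup>2) * pmf (q s) x
      - 4 * l * min (pmf (q s) x) (pmf (p s) x)"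
  let ?R = "(1 + 2 * l - 2 / 3 * l\<^sup>2) * 1 + (2 * l - 1 - 4 / 3 * l\<^sup>2) * 1
      - 4 * l * acceptance p q s"
  have "(?r has_sum ?R) UNIV"
    unfolding diff_conv_add_uminus
    by (intro has_sum_add has_sum_uminusI has_sum_cmult_right pmf_has_sum_1 acceptance_has_sum)
  then have "((\<lambda>x. ereal (?r x)) has_sum ereal ?R) UNIV"
    unfolding has_sum_def sum_ereal by (rule tendsto_ereal)
  then have "ereal ?R \<le> kl_div (p s) (q s)"
    by (rule has_sum_mono[OF _ kl_div_has_sum]) (rule kl_term_bound[OF l])
  also have "?R = 4 * l * (1 - acceptance p q s) - 2 * l\<^sup>2"
    by (simp add: algebra_simps)
  finally show ?thesis .
qed

section \<open>Averaging over the task\<close>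

lemma integrable_acceptance: "integrable (measure_pmf T) (acceptance p q)"
  by (rule measure_pmf.integrable_const_bound[of _ 1])
     (auto simp: acceptance_nonneg acceptance_le_1)

lemma task_acceptance_nonneg: "task_acceptance p q T \<ge> 0"
  by (simp add: task_acceptance_def acceptance_nonneg)

lemma task_acceptance_le_1: "task_acceptance p q T \<le> 1"
  unfolding task_acceptance_def
  by (rule measure_pmf.integral_le_const[OF integrable_acceptance]) (simp add: acceptance_le_1)

lemma task_speedup_jensen:
  assumes "c \<ge> 0"
  shows "task_speedup \<gamma> c p q T \<ge> f_spec \<gamma> (task_acceptance p q T) / (1 + real \<gamma> * c)"
proof -
  let ?m = "task_acceptance p q T"
  obtain d where d: "\<And>a. a \<ge> 0 \<Longrightarrow> f_spec \<gamma> a \<ge> f_spec \<gamma> ?m + d * (a - ?m)"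
    using f_spec_above_tangent[OF task_acceptance_nonneg] by blast
  have int: "integrable (measure_pmf T) (\<lambda>s. f_spec \<gamma> (acceptance p q s))"
  proof (rule measure_pmf.integrable_const_bound[of _ "f_spec \<gamma> 1"])
    show "AE s in measure_pmf T. norm (f_spec \<gamma> (acceptance p q s)) \<le> f_spec \<gamma> 1"
      by (simp add: f_spec_mono acceptance_nonneg acceptance_le_1
          order_trans[OF zero_le_one f_spec_ge_1])
  qed simp
  have "f_spec \<gamma> ?m = measure_pmf.expectation T (\<lambda>s. f_spec \<gamma> ?m + d * (acceptance p q s - ?m))"
    using integrable_acceptance[of T p q] by (simp add: task_acceptance_def)
  also have "\<dots> \<le> measure_pmf.expectation T (\<lambda>s. f_spec \<gamma> (acceptance p q s))"
    using integrable_acceptance[of T p q] int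
    by (intro integral_mono d acceptance_nonneg) auto
  finally show ?thesis
    using assms by (simp add: task_speedup_def divide_right_mono)
qed

lemma task_pinsker:
  assumes "task_kl p q T < \<infinity>"
  shows "2 * (1 - task_acceptance p q T)\<^sup>2 \<le> enn2real (task_kl p q T)"
proof -
  define l where "l = 1 - task_acceptance p q T"
  have l: "l \<ge> 0" by (simp add: l_def task_acceptance_le_1)
  have int: "integrable (measure_pmf T) (\<lambda>s. 4 * l * (1 - acceptance p q s))"
    using integrable_acceptance[of T p q] by simp
  have "ennreal (4 * l * (1 - acceptance p q s))
      \<le> e2ennreal (kl_div (p s) (q s)) + ennreal (2 * l\<^sup>2)" for s
  proof -
    have "kl_div (p s) (q s) \<ge> 0"
      "kl_div (p s) (q s) \<ge> ereal (4 * l * (1 - acceptance p q s) - 2 * l\<^sup>2)"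
      by (rule kl_div_nonneg, rule linearised_pinsker[OF l])
    then show ?thesis
      by (cases "kl_div (p s) (q s)") (auto simp flip: ennreal_plus intro!: ennreal_leI)
  qed
  then have "(\<integral>\<^sup>+s. ennreal (4 * l * (1 - acceptance p q s)) \<partial>measure_pmf T)
      \<le> (\<integral>\<^sup>+s. e2ennreal (kl_div (p s) (q s)) + ennreal (2 * l\<^sup>2) \<partial>measure_pmf T)"
    by (intro nn_integral_mono)
  also have "\<dots> = task_kl p q T + ennreal (2 * l\<^sup>2)"
    by (simp add: nn_integral_add task_kl_def)
  also have "(\<integral>\<^sup>+s. ennreal (4 * l * (1 - acceptance p q s)) \<partial>measure_pmf T)
      = ennreal (measure_pmf.expectation T (\<lambda>s. 4 * l * (1 - acceptance p q s)))"
    using l by (intro nn_integral_eq_integral int) (simp add: acceptance_le_1)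
  also have "measure_pmf.expectation T (\<lambda>s. 4 * l * (1 - acceptance p q s)) = 4 * l\<^sup>2"
    using integrable_acceptance[of T p q]
    by (simp add: task_acceptance_def l_def power2_eq_square)
  also have "task_kl p q T + ennreal (2 * l\<^sup>2) = ennreal (enn2real (task_kl p q T) + 2 * l\<^sup>2)"
    using assms by (simp add: ennreal_plus)
  finally have "4 * l\<^sup>2 \<le> enn2real (task_kl p q T) + 2 * l\<^sup>2"
    by (simp add: ennreal_le_iff del: ennreal_plus)
  then show ?thesis
    by (simp add: l_def)
qed

lemma kl_div_le_cross_ent: "kl_div P Q \<le> cross_ent P Q"
proof (rule has_sum_le_finite_sums[OF kl_div_has_sum])
  fix F :: "'a set"
  assume "finite F"
  let ?k = "\<lambda>x. ereal (pmf P x) * eln (ereal (pmf P x) / ereal (pmf Q x))"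
  let ?l = "\<lambda>x. ereal (pmf P x) * eln (ereal (pmf Q x))"
  have np: "?l x \<le> 0" for x
    by (auto simp: eln_def ereal_mult_le_0_iff pmf_le_1 mult_nonneg_nonpos)
  have le: "?k x \<le> - ?l x" for x
  proof -
    consider "pmf P x = 0" | "pmf P x > 0" "pmf Q x = 0" | "pmf P x > 0" "pmf Q x > 0"
      by (metis pmf_nonneg less_le)
    then show ?thesis
    proof cases
      case 3
      have "pmf P x * ln (pmf P x) \<le> 0"
        using 3 by (simp add: mult_nonneg_nonpos pmf_le_1)
      then have "pmf P x * ln (pmf P x / pmf Q x) \<le> - (pmf P x * ln (pmf Q x))"
        using 3 by (simp add: ln_div right_diff_distrib)
      moreover have "\<not> pmf P x / pmf Q x \<le> 0"
        using 3 by (simp add: not_le)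
      ultimately show ?thesis
        using 3 by (simp add: eln_def)
    qed (auto simp: eln_def)
  qed
  have "sum ?k F \<le> - sum ?l F"
    using \<open>finite F\<close>
  proof induction
    case (insert x F)
    have "sum ?l F \<le> 0" by (intro sum_nonpos np)
    then have "- ?l x + - sum ?l F = - (?l x + sum ?l F)"
      using np[of x] by (cases "?l x"; cases "sum ?l F") auto
    moreover have "?k x + sum ?k F \<le> - ?l x + - sum ?l F"
      by (intro add_mono le insert.IH)
    ultimately show ?case
      using insert.hyps by simp
  qed simp
  also have "- cross_ent P Q \<le> sum ?l F"
    by (rule has_sum_mono_neutral[OF cross_ent_has_sum has_sum_finite[OF \<open>finite F\<close>]])
       (use np in auto)
  then have "- sum ?l F \<le> cross_ent P Q"
    by (simp add: ereal_uminus_le_reorder)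
  finally show "sum ?k F \<le> cross_ent P Q" .
qed

lemma task_kl_le_task_cross_ent: "task_kl p q T \<le> task_cross_ent p q T"
  unfolding task_kl_def task_cross_ent_def
  by (intro nn_integral_mono e2ennreal_mono kl_div_le_cross_ent)

lemma one_minus_sqrt_half_nonneg:
  assumes "D \<le> (2::ennreal)"
  shows "0 \<le> 1 - sqrt (1/2 * enn2real D)"
proof -
  have "enn2real D \<le> 2"
    using enn2real_mono[OF assms] by simp
  then show ?thesis
    using real_sqrt_le_mono[of "1/2 * enn2real D" 1] by simp
qed

theorem theorem1:
  fixes \<gamma> :: nat and c :: real
    and p q :: "'v list \<Rightarrow> 'v pmf" and T :: "'v list pmf"
  assumes "\<gamma> \<ge> 1" and "c \<in> {0..<1}"
  shows
    "f_spec \<gamma> ` {0..<1} \<subseteq> {0<..} \<and>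
     strict_mono_on {0..<1} (f_spec \<gamma>) \<and>
     (\<gamma> \<ge> 2 \<longrightarrow> convex_on {0..<1} (f_spec \<gamma>)) \<and>
     (\<gamma> = 1 \<longrightarrow> (\<exists>a b. \<forall>\<alpha>\<in>{0..<1}. f_spec \<gamma> \<alpha> = a * \<alpha> + b)) \<and>
     task_speedup \<gamma> c p q T \<ge> f_spec \<gamma> (task_acceptance p q T) / (1 + real \<gamma> * c) \<and>
     (task_kl p q T \<le> 2 \<longrightarrow>
        f_spec \<gamma> (task_acceptance p q T) / (1 + real \<gamma> * c)
          \<ge> f_spec \<gamma> (1 - sqrt (1/2 * enn2real (task_kl p q T))) / (1 + real \<gamma> * c)) \<and>
     (task_cross_ent p q T \<le> 2 \<longrightarrow>
        f_spec \<gamma> (1 - sqrt (1/2 * enn2real (task_kl p q T))) / (1 + real \<gamma> * c)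
          \<ge> f_spec \<gamma> (1 - sqrt (1/2 * enn2real (task_cross_ent p q T))) / (1 + real \<gamma> * c))"
proof (intro conjI impI)
  have c: "c \<ge> 0" using assms by simp
  then have pos: "0 \<le> 1 + real \<gamma> * c" by simp
  show "f_spec \<gamma> ` {0..<1} \<subseteq> {0<..}"
    using f_spec_ge_1 by (force intro: less_le_trans[OF zero_less_one])
  show "strict_mono_on {0..<1} (f_spec \<gamma>)"
    using assms by (auto intro!: strict_mono_onI f_spec_strict_mono)
  show "convex_on {0..<1} (f_spec \<gamma>)"
    by (rule convex_on_subset[OF convex_on_f_spec]) auto
  show "\<exists>a b. \<forall>\<alpha>\<in>{0..<1}. f_spec \<gamma> \<alpha> = a * \<alpha> + b" if "\<gamma> = 1"
    using that by (intro exI[of _ 1]) (simp add: f_spec_def)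
  show "task_speedup \<gamma> c p q T \<ge> f_spec \<gamma> (task_acceptance p q T) / (1 + real \<gamma> * c)"
    using c by (rule task_speedup_jensen)
  show "f_spec \<gamma> (task_acceptance p q T) / (1 + real \<gamma> * c)
      \<ge> f_spec \<gamma> (1 - sqrt (1/2 * enn2real (task_kl p q T))) / (1 + real \<gamma> * c)"
    if le: "task_kl p q T \<le> 2"
  proof (intro divide_right_mono f_spec_mono pos one_minus_sqrt_half_nonneg le)
    have "task_kl p q T < \<infinity>"
      using le by (rule le_less_trans) simp
    then have "(1 - task_acceptance p q T)\<^sup>2 \<le> 1/2 * enn2real (task_kl p q T)"
      using task_pinsker by fastforce
    then have "1 - task_acceptance p q T \<le> sqrt (1/2 * enn2real (task_kl p q T))"
      by (rule real_le_rsqrt)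
    then show "1 - sqrt (1/2 * enn2real (task_kl p q T)) \<le> task_acceptance p q T"
      by simp
  qed
  show "f_spec \<gamma> (1 - sqrt (1/2 * enn2real (task_kl p q T))) / (1 + real \<gamma> * c)
      \<ge> f_spec \<gamma> (1 - sqrt (1/2 * enn2real (task_cross_ent p q T))) / (1 + real \<gamma> * c)"
    if le: "task_cross_ent p q T \<le> 2"
  proof (intro divide_right_mono f_spec_mono pos one_minus_sqrt_half_nonneg le)
    have "task_cross_ent p q T < top"
      using le by (rule le_less_trans) simp
    then have "enn2real (task_kl p q T) \<le> enn2real (task_cross_ent p q T)"
      by (intro enn2real_mono task_kl_le_task_cross_ent)
    then show "1 - sqrt (1/2 * enn2real (task_cross_ent p q T))
        \<le> 1 - sqrt (1/2 * enn2real (task_kl p q T))"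
      by simp
  qed
qed

end
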